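(* Let $K\subset L$ be fields and let $T=K+XL[X]$. Let $D$ be a subring of $K$ and let $R=D+XL[X]$. Then $R$ is a BFD if and only if $T$ is a BFD and $D$ is a field.
   Context: All rings are commutative with unity. For $A\subset B$ rings, $A+XB[X]$ denotes the subring of the polynomial ring $B[X]$ consisting of the polynomials whose constant term lies in $A$. An integral domain is atomic if every nonzero noninvertible element is a product of irreducible elements. An integral domain is a bounded factorization domain (BFD) if it is atomic and for each nonzero nonunit there is a bound on the length of its factorizations into products of irreducible elements. *)

theory Defs
  imports "HOL-Algebra.Subrings" "HOL-Algebra.Ring_Divisibility" "HOL-Algebra.UnivPoly"
begin

text \<open>
  The ring \<open>A + X B[X]\<close> for a subset \<open>A\<close> of a ring \<open>B\<close>, realised inside the library's polynomial
  ring \<^term>\<open>UP B\<close>: the operations are those of \<^term>\<open>UP B\<close>, only the carrier is restricted.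
  It is a ring when \<open>A\<close> is a subring of \<open>B\<close>.
\<close>

definition const_in :: "('a, 'm) ring_scheme \<Rightarrow> 'a set \<Rightarrow> ('a, nat \<Rightarrow> 'a) up_ring"
  where "const_in B A =
    (UP B) \<lparr> carrier := {p \<in> carrier (UP B). coeff (UP B) p 0 \<in> A} \<rparr>"

text \<open>
  The library predicate \<^term>\<open>factors R fs a\<close> requires neither the listed factors to lie in the
  carrier nor, for irreducible elements, to be nonzero; both are imposed here.
\<close>

definition irreducible_factorization :: "('a, 'm) ring_scheme \<Rightarrow> 'a list \<Rightarrow> 'a \<Rightarrow> bool"
  where "irreducible_factorization R fs a \<longleftrightarrow>
    set fs \<subseteq> carrier R \<and> (\<forall>x \<in> set fs. ring_irreducible\<^bsub>R\<^esub> x) \<and>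
    foldr (\<otimes>\<^bsub>R\<^esub>) fs \<one>\<^bsub>R\<^esub> = a"

definition atomic_domain :: "('a, 'm) ring_scheme \<Rightarrow> bool"
  where "atomic_domain R \<longleftrightarrow> domain R \<and>
    (\<forall>a \<in> carrier R. a \<noteq> \<zero>\<^bsub>R\<^esub> \<and> a \<notin> Units R \<longrightarrow> (\<exists>fs. irreducible_factorization R fs a))"

definition bounded_factorization_domain :: "('a, 'm) ring_scheme \<Rightarrow> bool"
  where "bounded_factorization_domain R \<longleftrightarrow> atomic_domain R \<and>
    (\<forall>a \<in> carrier R. a \<noteq> \<zero>\<^bsub>R\<^esub> \<and> a \<notin> Units R \<longrightarrow>
      (\<exists>N::nat. \<forall>fs. irreducible_factorization R fs a \<longrightarrow> length fs \<le> N))"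

end

theory Submission
  imports Defs
begin

text \<open>
  If \<open>E\<close> is a field, the degree is an additive length function on \<open>E + X L[X]\<close> whose zero set on
  nonzero elements consists of units, so this ring is a BFD. Conversely, a nonzero nonunit \<open>d \<in> D\<close>
  would give \<open>X = d\<^sup>n (d\<^sup>-\<^sup>n X)\<close> in \<open>D + X L[X]\<close> for every \<open>n\<close>, hence arbitrarily long factorizations
  of \<open>X\<close>.
\<close>

context "domain"
begin

lemma irreducible_factorization_append:
  assumes "irreducible_factorization R fs a" and "irreducible_factorization R gs b"
  shows "irreducible_factorization R (fs @ gs) (a \<otimes> b)"
proof -
  have b: "foldr (\<otimes>) gs \<one> = b" "b \<in> carrier R"
    using assms(2) multlist_closed[of gs] unfolding irreducible_factorization_def by auto
  have "set fs \<subseteq> carrier R \<Longrightarrow> foldr (\<otimes>) (fs @ gs) \<one> = foldr (\<otimes>) fs \<one> \<otimes> b"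
    using b by (induction fs) (auto simp: m_assoc)
  then show ?thesis
    using assms unfolding irreducible_factorization_def by auto
qed

lemma irreducible_factorization_single:
  assumes "a \<in> carrier R" "ring_irreducible a"
  shows "irreducible_factorization R [a] a"
  using assms unfolding irreducible_factorization_def by simp

text \<open>Splitting \<open>a\<close> into two nonunits strictly lowers \<open>h\<close>, so
  refinement terminates. Each irreducible factor contributes at least 1 to \<open>h a\<close>, so
  \<open>h a\<close> bounds every factorization length.\<close>

lemma bounded_factorization_domainI:
  fixes h :: "'a \<Rightarrow> nat"
  assumes add: "\<And>a b. \<lbrakk>a \<in> carrier R - {\<zero>}; b \<in> carrier R - {\<zero>}\<rbrakk> \<Longrightarrow> h (a \<otimes> b) = h a + h b"
    and unit: "\<And>a. \<lbrakk>a \<in> carrier R - {\<zero>}; h a = 0\<rbrakk> \<Longrightarrow> a \<in> Units R"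
  shows "bounded_factorization_domain R"
proof -
  have "\<exists>fs. irreducible_factorization R fs a" if "a \<in> carrier R - {\<zero>}" "a \<notin> Units R" for a
    using that
  proof (induction "h a" arbitrary: a rule: less_induct)
    case less
    show ?case
    proof (cases "ring_irreducible a")
      case True
      then show ?thesis
        using less.prems irreducible_factorization_single by blast
    next
      case False
      then obtain b c where bc: "b \<in> carrier R" "c \<in> carrier R" "a = b \<otimes> c"
        "b \<notin> Units R" "c \<notin> Units R"
        using ring_irreducibleI less.prems by metis
      then have nz: "b \<in> carrier R - {\<zero>}" "c \<in> carrier R - {\<zero>}"
        using less.prems by auto
      \<comment> \<open>By \<open>unit\<close>, both nonunit factors have positive \<open>h\<close>,
        so each loses something against the sum.\<close>
      have "h b < h a" "h c < h a"
        using add[OF nz] unit[OF nz(1)] unit[OF nz(2)] bc by auto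
      then show ?thesis
        using less.hyps nz bc irreducible_factorization_append by meson
    qed
  qed
  moreover have "length fs \<le> h a" if "irreducible_factorization R fs a" for fs a
  proof -
    \<comment> \<open>Nonvanishing of the product is carried through the induction because
      \<open>add\<close> applies only to nonzero elements.\<close>
    have "set fs \<subseteq> carrier R \<Longrightarrow> \<forall>x\<in>set fs. ring_irreducible x \<Longrightarrow>
      foldr (\<otimes>) fs \<one> \<noteq> \<zero> \<and> length fs \<le> h (foldr (\<otimes>) fs \<one>)"
    proof (induction fs)
      case (Cons x fs)
      have x: "x \<in> carrier R - {\<zero>}" "h x \<noteq> 0"
        using Cons.prems ring_irreducibleE(1,4)[of x] unit[of x] by auto
      have y: "foldr (\<otimes>) fs \<one> \<in> carrier R - {\<zero>}"
        using Cons multlist_closed[of fs] by auto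
      show ?case
        using add[OF x(1) y] x y Cons by (auto simp: integral_iff)
    qed simp
    then show ?thesis
      using that unfolding irreducible_factorization_def by blast
  qed
  ultimately show ?thesis
    unfolding bounded_factorization_domain_def atomic_domain_def
    using domain_axioms by (meson Diff_iff singletonD)
qed

text \<open>For a nonunit \<open>d\<close>, factoring \<open>d [^] n\<close> and its cofactor
  separately and concatenating the lists gives factorizations of \<open>a\<close> of length at least
  \<open>n\<close>, for every \<open>n\<close>.\<close>

lemma bounded_factorization_domain_unitI:
  assumes "bounded_factorization_domain R" and a: "a \<noteq> \<zero>" and d: "d \<in> carrier R"
    and dvd: "\<And>n::nat. \<exists>b\<in>carrier R. a = d [^] n \<otimes> b"
  shows "d \<in> Units R"
proof (rule ccontr)
  assume nu: "d \<notin> Units R"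
  have nonunit: "d \<otimes> b \<notin> Units R" if "b \<in> carrier R" for b
    using nu that d unit_factor by blast
  \<comment> \<open>One copy of \<open>d\<close> is moved into the cofactor. This makes the cofactor
    a nonunit, so atomicity yields a factorization of it whatever \<open>b\<close> is.\<close>
  have step: "\<exists>b\<in>carrier R. a = d [^] n \<otimes> (d \<otimes> b)" for n :: nat
    using dvd[of "Suc n"] d by (auto simp: m_assoc)
  have ca: "a \<in> carrier R" "a \<notin> Units R"
    using step[of 0] d nonunit by auto
  have dz: "d \<noteq> \<zero>"
    using step[of 0] a by auto
  have factorization: "\<exists>fs. irreducible_factorization R fs x"
    if "x \<in> carrier R" "x \<noteq> \<zero>" "x \<notin> Units R" for x
    using assms(1) that unfolding bounded_factorization_domain_def atomic_domain_def by blast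
  obtain ds where ds: "irreducible_factorization R ds d"
    using factorization d dz nu by blast
  \<comment> \<open>The empty product is the unit \<open>\<one>\<close>. Hence each copy of
    \<open>d\<close> adds at least one factor.\<close>
  then have "ds \<noteq> []"
    using nu unfolding irreducible_factorization_def by auto
  then have pos: "1 \<le> length ds"
    by (cases ds) auto
  have powers: "\<exists>fs. irreducible_factorization R fs (d [^] n) \<and> n \<le> length fs" for n :: nat
  proof (induction n)
    case 0
    then show ?case
      by (intro exI[of _ "[]"]) (simp add: irreducible_factorization_def)
  next
    case (Suc n)
    then obtain fs where "irreducible_factorization R fs (d [^] n)" "n \<le> length fs"
      by blast
    then show ?case
      using irreducible_factorization_append[OF _ ds] pos by (intro exI[of _ "fs @ ds"]) auto
  qed
  obtain N where N: "\<And>fs. irreducible_factorization R fs a \<Longrightarrow> length fs \<le> N"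
    using assms(1) a ca unfolding bounded_factorization_domain_def by blast
  obtain b where b: "b \<in> carrier R" "a = d [^] Suc N \<otimes> (d \<otimes> b)"
    using step by blast
  have "d \<otimes> b \<noteq> \<zero>"
    using a b d by auto
  then obtain gs where gs: "irreducible_factorization R gs (d \<otimes> b)"
    using factorization nonunit b d by blast
  obtain fs where "irreducible_factorization R fs (d [^] Suc N)" "Suc N \<le> length fs"
    using powers by blast
  then show False
    using N[of "fs @ gs"] irreducible_factorization_append[OF _ gs] b(2) by auto
qed

end

lemma const_in_simps [simp]:
  "carrier (const_in L A) = {p \<in> carrier (UP L). coeff (UP L) p 0 \<in> A}"
  "monoid.mult (const_in L A) = monoid.mult (UP L)"
  "\<one>\<^bsub>const_in L A\<^esub> = \<one>\<^bsub>UP L\<^esub>"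
  "\<zero>\<^bsub>const_in L A\<^esub> = \<zero>\<^bsub>UP L\<^esub>"
  by (simp_all add: const_in_def)

context UP_domain
begin

text \<open>The constant term of a product is the product of the constant terms, so the carrier is a
  subring of the polynomial domain.\<close>

lemma domain_const_in:
  assumes "subring A R"
  shows "domain (const_in R A)"
proof -
  note A = subringE[OF assms]
  have "subring {p \<in> carrier P. coeff P p 0 \<in> A} P"
  proof (rule P.subringI)
    fix p q
    assume "p \<in> {p \<in> carrier P. coeff P p 0 \<in> A}" "q \<in> {p \<in> carrier P. coeff P p 0 \<in> A}"
    moreover from this have "coeff P p 0 \<otimes> coeff P q 0 \<in> carrier R"
      by simp
    ultimately show "p \<otimes>\<^bsub>P\<^esub> q \<in> {p \<in> carrier P. coeff P p 0 \<in> A}"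
      using A(6) by simp
  qed (use A in auto)
  then show ?thesis
    unfolding const_in_def P_def[symmetric] by (rule domain.subring_is_domain[OF UP_domain])
qed

lemma monom_0_in_Units_const_in:
  assumes "subring A R" "a \<in> A" "b \<in> A" "a \<otimes> b = \<one>"
  shows "monom P a 0 \<in> Units (const_in R A)"
proof -
  have ab: "a \<in> carrier R" "b \<in> carrier R" "b \<otimes> a = \<one>"
    using assms subringE(1) R.m_comm by (blast, blast, metis subsetD)
  have "monom P a 0 \<otimes>\<^bsub>P\<^esub> monom P b 0 = \<one>\<^bsub>P\<^esub>" "monom P b 0 \<otimes>\<^bsub>P\<^esub> monom P a 0 = \<one>\<^bsub>P\<^esub>"
    using monom_mult[of a b 0 0] monom_mult[of b a 0 0] ab assms(4) by auto
  then show ?thesis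
    using assms ab unfolding Units_def
    by (auto simp: P_def[symmetric] intro!: exI[of _ "monom P b 0"])
qed

text \<open>The length function is the degree: it is additive over a domain, and degree 0 leaves
  only nonzero constants from \<open>E\<close>, which are invertible within
  \<open>E\<close>.\<close>

lemma bounded_factorization_domain_const_in:
  assumes "subfield E R"
  shows "bounded_factorization_domain (const_in R E)"
proof -
  have E: "subring E R"
    using assms by (rule subfieldE)
  interpret C: "domain" "const_in R E"
    using E by (rule domain_const_in)
  show ?thesis
  proof (rule C.bounded_factorization_domainI[where h = "deg R"])
    fix p
    assume p: "p \<in> carrier (const_in R E) - {\<zero>\<^bsub>const_in R E\<^esub>}" and "deg R p = 0"
    \<comment> \<open>In degree 0 the constant term is the leading coefficient, hence
      nonzero.\<close>
    then have c: "coeff P p 0 \<in> E - {\<zero>}" "p = monom P (coeff P p 0) 0"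
      using lcoeff_nonzero_nonzero[of p] up_repr_le[of p 0] by (auto simp: P_def[symmetric])
    show "p \<in> Units (const_in R E)"
      using monom_0_in_Units_const_in[OF E] R.subfield_m_inv[OF assms c(1)] c by (metis DiffD1)
  qed (auto simp: P_def[symmetric])
qed

end

text \<open>The unit criterion is applied to the constant \<open>?d\<close> and the element
  \<open>?X\<close>, which is divisible by every power of \<open>?d\<close>.\<close>

lemma (in field) subfield_if_bounded_factorization_domain:
  assumes D: "subring D R" and bfd: "bounded_factorization_domain (const_in R D)"
  shows "subfield D R"
proof (rule subfieldI'[OF D])
  interpret U: UP_domain R "UP R"
    by unfold_locales
  interpret C: "domain" "const_in R D"
    using D by (rule U.domain_const_in)
  fix d
  assume d: "d \<in> D - {\<zero>}"
  then have dR: "d \<in> carrier R" "d \<in> Units R"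
    using subringE(1)[OF D] by (auto simp: field_Units)
  let ?d = "monom (UP R) d 0" and ?X = "monom (UP R) \<one> 1"
  have pow: "?d [^]\<^bsub>const_in R D\<^esub> n = monom (UP R) (d [^] n) 0" for n :: nat
    using dR U.monom_mult[of _ d 0 0] by (induction n) auto
  have "?d \<in> Units (const_in R D)"
  proof (rule C.bounded_factorization_domain_unitI[OF bfd])
    have "coeff (UP R) ?X 1 \<noteq> coeff (UP R) \<zero>\<^bsub>UP R\<^esub> 1"
      by simp
    then show "?X \<noteq> \<zero>\<^bsub>const_in R D\<^esub>"
      by (metis const_in_simps(4))
    show "?d \<in> carrier (const_in R D)"
      using d dR by simp
    fix n :: nat
    \<comment> \<open>The inverse is taken in the big field and may lie outside \<open>D\<close>. As
      a coefficient of \<open>X\<close> it is still allowed, since the cofactor has constant term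
      0.\<close>
    have i: "inv (d [^] n) \<in> carrier R" "d [^] n \<otimes> inv (d [^] n) = \<one>"
      using dR Units_pow_closed by auto
    then have "?X = monom (UP R) (d [^] n) 0 \<otimes>\<^bsub>UP R\<^esub> monom (UP R) (inv (d [^] n)) 1"
      using U.monom_mult[of "d [^] n" "inv (d [^] n)" 0 1] dR by simp
    then show "\<exists>b\<in>carrier (const_in R D).
        ?X = ?d [^]\<^bsub>const_in R D\<^esub> n \<otimes>\<^bsub>const_in R D\<^esub> b"
      using i subringE(2)[OF D]
      by (intro bexI[of _ "monom (UP R) (inv (d [^] n)) 1"]) (auto simp: pow)
  qed
  then obtain q where q: "q \<in> carrier (UP R)" "coeff (UP R) q 0 \<in> D" "?d \<otimes>\<^bsub>UP R\<^esub> q = \<one>\<^bsub>UP R\<^esub>"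
    unfolding Units_def by auto
  \<comment> \<open>Comparing constant terms in \<open>?d \<otimes> q = \<one>\<close> identifies
    \<open>inv d\<close> with the constant term of \<open>q\<close>, which lies in
    \<open>D\<close>.\<close>
  have "d \<otimes> coeff (UP R) q 0 = coeff (UP R) (?d \<otimes>\<^bsub>UP R\<^esub> q) 0"
    using q(1) dR by (simp add: U.monom_mult_is_smult)
  then have "d \<otimes> coeff (UP R) q 0 = \<one>"
    using q by simp
  then show "inv d \<in> D"
    using q dR comm_inv_char U.coeff_closed by metis
qed

theorem proposition2p3:
  fixes L :: "('a, 'm) ring_scheme" and K D :: "'a set"
  assumes "field L" and "subfield K L" and "subring D (L\<lparr>carrier := K\<rparr>)"
  shows "bounded_factorization_domain (const_in L D) \<longleftrightarrow>
    bounded_factorization_domain (const_in L K) \<and> field (L\<lparr>carrier := D\<rparr>)"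
proof -
  interpret field L
    by (rule assms(1))
  interpret U: UP_domain L "UP L"
    by unfold_locales
  interpret K: ring "L\<lparr>carrier := K\<rparr>"
    using assms(2) by (intro subring_is_ring subfieldE)
  have sub: "D \<subseteq> carrier L"
    using subringE(1)[OF assms(3)] subfieldE(3)[OF assms(2)] by auto
  \<comment> \<open>Restricting the carrier to \<open>K\<close> and then to \<open>D\<close> gives
    the same ring as restricting it to \<open>D\<close> directly.\<close>
  have D: "subring D L"
    using K.subring_is_ring[OF assms(3)] ring_incl_imp_subring[OF sub] by simp
  \<comment> \<open>The degree argument serves \<open>K\<close>, and also \<open>D\<close> in the
    reverse direction; \<open>subfield_iff\<close> translates between subfields of \<open>L\<close>
    and fields on a restricted carrier.\<close>
  show ?thesis
    using subfield_if_bounded_factorization_domain[OF D] U.bounded_factorization_domain_const_in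
      assms(2) subfield_iff sub by blast
qed

end
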